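(* Let $D=(V,A)$ be a finite directed graph, $\{S,T\}$ a partition of $V$ into nonempty sets with no arc from $T$ to $S$, and $w\in\mathbb{Z}_+^A$. Let $\xi\in\{0,1\}^{A[S,T]}$ be an optimal flow for (MSF) and let $(p,q)\in\mathbb{Z}^S\times\mathbb{Z}^T$ satisfy conditions (i)–(iii) together with $\xi$ and moreover $w(a)+p(u)-q(v)=0$ for every $a=uv\in A[S,T]$ with $\xi(a)=1$. Let $\tilde B_T$ be a minimum-$w'$-weight $r_T$-arborescence in $D_T$ with $R(\tilde B_T\cap A[T])=\mathrm{supp}^+(-\partial\xi|_T)$, and let $\rho^*$ be an integral optimal solution of (D$'$) with $\rho^*(v)\ge0$ for all $v\in T$. Let $\tilde B_S\subseteq A_S$ be an arc set of minimum $w''$-weight among those whose reversal is an $r_S$-arborescence in the reversal of $D_S$ and with $R^*(\tilde B_S\cap A[S])=\mathrm{supp}^+(\partial\xi|_S)$, and let $\pi^*$ be an integral optimal solution of (D$''$) with $\pi^*(u)\ge0$ for all $u\in S$. Let $F=\{a\in A[S,T]:\xi(a)=1\}$ and define $x^*=\chi_{F\cup(\tilde B_S\cap A[S])\cup(\tilde B_T\cap A[T])}\in\{0,1\}^A$, $y^*(S')=\pi^*(S')$ for $\emptyset\ne S'\subseteq S$, and $z^*(T')=\rho^*(T')$ for $\emptyset\ne T'\subseteq T$. Then $x^*$ is an optimal solution of (P) and $(y^*,z^* )$ is an optimal solution of (D).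
   Context: An arc $uv$ leaves $u$ and enters $v$. In a digraph, $\delta^+X$ ($\delta^-X$) is the set of arcs leaving (entering) vertex set $X$, $\delta^\pm u=\delta^\pm\{u\}$. $A[X]$: arcs of $A$ with both ends in $X$; $A[S,T]=\{uv\in A:u\in S,v\in T\}$; $D[S]=(S,A[S])$, $D[T]=(T,A[T])$. $\chi_Y$ is the characteristic vector of $Y$. A branching is an arc set with no directed cycle in which every vertex is entered by at most one arc; an $r$-arborescence is a branching in which every vertex other than $r$ is entered by an arc. For a branching $B$ in $D[T]$, $R(B)$ = vertices of $T$ entered by no arc of $B$; a cobranching is an arc set whose reversal is a branching, and for a cobranching $B$ in $D[S]$, $R^*(B)$ = vertices of $S$ left by no arc of $B$. $\mathrm{supp}^+(\eta)=\{u:\eta(u)>0\}$. $g_T(\eta)=\min\{w(B):B\text{ branching in }D[T],R(B)=\mathrm{supp}^+(\eta)\}$ for $\eta\in\mathbb{Z}_+^T$ when such exists, else $+\infty$; $g_S$ analogous with cobranchings in $D[S]$ and $R^*$. For $\xi\in\{0,1\}^{A[S,T]}$, $\partial\xi(v)=|\{a\in\delta^+v:\xi(a)=1\}|-|\{a\in\delta^-v:\xi(a)=1\}|$. Feasible: $g_S(\partial\xi|_S),g_T(-\partial\xi|_T)<\infty$. (MSF): minimize $\sum_{a\in A[S,T]}w(a)\xi(a)+g_S(\partial\xi|_S)+g_T(-\partial\xi|_T)$; optimal flow = feasible minimizer. $g_S[-p](\eta)=g_S(\eta)-\sum_up(u)\eta(u)$, $g_T[+q](\zeta)=g_T(\zeta)+\sum_vq(v)\zeta(v)$.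 Conditions: (i) for $a=uv\in A[S,T]$, $\xi(a)=1\Rightarrow w(a)+p(u)-q(v)\le0$, $\xi(a)=0\Rightarrow w(a)+p(u)-q(v)\ge0$; (ii) $\partial\xi|_S\in\arg\min g_S[-p]$; (iii) $-\partial\xi|_T\in\arg\min g_T[+q]$. $D_T=(V_T,A_T)$: $V_T=\{r_T\}\cup T$, $A_T=\{r_Tv:v\in T\}\cup A[T]$, $w'(r_Tv)=q(v)$, $w'(uv)=w(uv)$ for $uv\in A[T]$. (D$'$): maximize $\sum_{v\in T}\rho(v)+\sum_{T'\subseteq T,|T'|\ge2}\rho(T')$ subject to $\rho(v)+\sum_{T'\subseteq T,|T'|\ge2,\ a\in\delta^-T'}\rho(T')\le w'(a)$ for every $a=uv\in A_T$ ($\delta^-$ taken in $D_T$), and $\rho(T')\ge0$ for $|T'|\ge2$ (here $\rho(v)$ means $\rho(\{v\})$). $D_S=(V_S,A_S)$: $V_S=\{r_S\}\cup S$, $A_S=\{ur_S:u\in S\}\cup A[S]$, $w''(ur_S)=-p(u)$, $w''(uv)=w(uv)$ for $uv\in A[S]$. (D$''$): maximize $\sum_{u\in S}\pi(u)+\sum_{S'\subseteq S,|S'|\ge2}\pi(S')$ subject to $\pi(u)+\sum_{S'\subseteq S,|S'|\ge2,\ a\in\delta^+S'}\pi(S')\le w''(a)$ for every $a=uv\in A_S$ ($\delta^+$ in $D_S$), and $\pi(S')\ge0$ for $|S'|\ge2$. (P): minimize $\sum_{a\in A}w(a)x(a)$ s.t. $\sum_{a\in\delta^+S'}x(a)\ge1$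 ($\emptyset\ne S'\subseteq S$), $\sum_{a\in\delta^-T'}x(a)\ge1$ ($\emptyset\ne T'\subseteq T$), $x\ge0$ ($\delta^\pm$ in $D$). (D): maximize $\sum_{\emptyset\ne S'\subseteq S}y(S')+\sum_{\emptyset\ne T'\subseteq T}z(T')$ s.t. $\sum_{S'\subseteq S,a\in\delta^+S'}y(S')+\sum_{T'\subseteq T,a\in\delta^-T'}z(T')\le w(a)$ ($a\in A$), $y,z\ge0$.
   Formalization: The directed graph D is assumed to have no loops (parallel arcs are allowed); with a loop at v of weight 0 the printed constraint of (D') forces ρ(v) ≤ 0 and the claim can fail. *)

theory Defs
  imports "Graph_Theory.Graph_Theory" "HOL-Library.Extended_Real" "HOL-Library.Indicator_Function"
begin

text \<open>Arcs are abstract objects with a tail and a head, so parallel arcs are allowed. \<open>D \<restriction> X\<close> is the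
  induced subdigraph, so \<open>arcs (D \<restriction> X)\<close> is the set \<open>A[X]\<close>.\<close>

definition cut_out :: "('a, 'b) pre_digraph \<Rightarrow> 'a set \<Rightarrow> 'b set" where
  "cut_out G X = {a \<in> arcs G. tail G a \<in> X \<and> head G a \<notin> X}"

definition cut_in :: "('a, 'b) pre_digraph \<Rightarrow> 'a set \<Rightarrow> 'b set" where
  "cut_in G X = {a \<in> arcs G. tail G a \<notin> X \<and> head G a \<in> X}"

definition arcs_between :: "('a, 'b) pre_digraph \<Rightarrow> 'a set \<Rightarrow> 'a set \<Rightarrow> 'b set" where
  "arcs_between G X Y = {a \<in> arcs G. tail G a \<in> X \<and> head G a \<in> Y}"

definition rev_digraph :: "('a, 'b) pre_digraph \<Rightarrow> ('a, 'b) pre_digraph" where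
  "rev_digraph G = G\<lparr>tail := head G, head := tail G\<rparr>"

definition branching :: "('a, 'b) pre_digraph \<Rightarrow> 'b set \<Rightarrow> bool" where
  "branching G B \<longleftrightarrow> B \<subseteq> arcs G \<and> \<not> (\<exists>c. pre_digraph.cycle G c \<and> set c \<subseteq> B) \<and> inj_on (head G) B"

definition cobranching :: "('a, 'b) pre_digraph \<Rightarrow> 'b set \<Rightarrow> bool" where
  "cobranching G B \<longleftrightarrow> branching (rev_digraph G) B"

definition arborescence :: "('a, 'b) pre_digraph \<Rightarrow> 'a \<Rightarrow> 'b set \<Rightarrow> bool" where
  "arborescence G r B \<longleftrightarrow> branching G B \<and> (\<forall>v \<in> verts G. v \<noteq> r \<longrightarrow> in_arcs G v \<inter> B \<noteq> {})"

text \<open>The sets \<open>R(B)\<close> and \<open>R\<^sup>*(B)\<close>.\<close>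

definition unentered :: "('a, 'b) pre_digraph \<Rightarrow> 'b set \<Rightarrow> 'a set" where
  "unentered G B = {v \<in> verts G. in_arcs G v \<inter> B = {}}"

definition unleft :: "('a, 'b) pre_digraph \<Rightarrow> 'b set \<Rightarrow> 'a set" where
  "unleft G B = {u \<in> verts G. out_arcs G u \<inter> B = {}}"

text \<open>Integer vectors on a vertex set \<open>X\<close> are functions on the whole type of which only the values on
  \<open>X\<close> matter.\<close>

definition suppp :: "'a set \<Rightarrow> ('a \<Rightarrow> int) \<Rightarrow> 'a set" where
  "suppp X \<eta> = {u \<in> X. \<eta> u > 0}"

definition nonneg_on :: "'a set \<Rightarrow> ('a \<Rightarrow> int) \<Rightarrow> bool" where
  "nonneg_on X \<eta> \<longleftrightarrow> (\<forall>u \<in> X. \<eta> u \<ge> 0)"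

definition g_T :: "('a, 'b) pre_digraph \<Rightarrow> 'a set \<Rightarrow> ('b \<Rightarrow> int) \<Rightarrow> ('a \<Rightarrow> int) \<Rightarrow> ereal" where
  "g_T D T w \<eta> =
    (let \<B> = {B. branching (D \<restriction> T) B \<and> unentered (D \<restriction> T) B = suppp T \<eta>}
     in if nonneg_on T \<eta> \<and> \<B> \<noteq> {} then ereal (of_int (Min ((\<lambda>B. \<Sum>a\<in>B. w a) ` \<B>))) else \<infinity>)"

definition g_S :: "('a, 'b) pre_digraph \<Rightarrow> 'a set \<Rightarrow> ('b \<Rightarrow> int) \<Rightarrow> ('a \<Rightarrow> int) \<Rightarrow> ereal" where
  "g_S D S w \<eta> =
    (let \<B> = {B. cobranching (D \<restriction> S) B \<and> unleft (D \<restriction> S) B = suppp S \<eta>}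
     in if nonneg_on S \<eta> \<and> \<B> \<noteq> {} then ereal (of_int (Min ((\<lambda>B. \<Sum>a\<in>B. w a) ` \<B>))) else \<infinity>)"

definition g_S_shift ::
    "('a, 'b) pre_digraph \<Rightarrow> 'a set \<Rightarrow> ('b \<Rightarrow> int) \<Rightarrow> ('a \<Rightarrow> int) \<Rightarrow> ('a \<Rightarrow> int) \<Rightarrow> ereal" where
  "g_S_shift D S w p \<eta> = g_S D S w \<eta> - ereal (of_int (\<Sum>u\<in>S. p u * \<eta> u))"

definition g_T_shift ::
    "('a, 'b) pre_digraph \<Rightarrow> 'a set \<Rightarrow> ('b \<Rightarrow> int) \<Rightarrow> ('a \<Rightarrow> int) \<Rightarrow> ('a \<Rightarrow> int) \<Rightarrow> ereal" where
  "g_T_shift D T w q \<zeta> = g_T D T w \<zeta> + ereal (of_int (\<Sum>v\<in>T. q v * \<zeta> v))"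

text \<open>A flow \<open>\<xi>\<close> lives on the arcs from \<open>S\<close> to \<open>T\<close> only; this is why its boundary counts only those arcs.\<close>

definition boundary ::
    "('a, 'b) pre_digraph \<Rightarrow> 'a set \<Rightarrow> 'a set \<Rightarrow> ('b \<Rightarrow> int) \<Rightarrow> 'a \<Rightarrow> int" where
  "boundary D S T \<xi> v =
     int (card {a \<in> arcs_between D S T. tail D a = v \<and> \<xi> a = 1})
   - int (card {a \<in> arcs_between D S T. head D a = v \<and> \<xi> a = 1})"

definition msf_feasible ::
    "('a, 'b) pre_digraph \<Rightarrow> 'a set \<Rightarrow> 'a set \<Rightarrow> ('b \<Rightarrow> int) \<Rightarrow> ('b \<Rightarrow> int) \<Rightarrow> bool" where
  "msf_feasible D S T w \<xi> \<longleftrightarrow>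
     (\<forall>a \<in> arcs_between D S T. \<xi> a \<in> {0, 1}) \<and>
     g_S D S w (boundary D S T \<xi>) < \<infinity> \<and> g_T D T w (\<lambda>v. - boundary D S T \<xi> v) < \<infinity>"

definition msf_cost ::
    "('a, 'b) pre_digraph \<Rightarrow> 'a set \<Rightarrow> 'a set \<Rightarrow> ('b \<Rightarrow> int) \<Rightarrow> ('b \<Rightarrow> int) \<Rightarrow> ereal" where
  "msf_cost D S T w \<xi> =
     ereal (of_int (\<Sum>a\<in>arcs_between D S T. w a * \<xi> a))
     + g_S D S w (boundary D S T \<xi>) + g_T D T w (\<lambda>v. - boundary D S T \<xi> v)"

definition optimal_flow ::
    "('a, 'b) pre_digraph \<Rightarrow> 'a set \<Rightarrow> 'a set \<Rightarrow> ('b \<Rightarrow> int) \<Rightarrow> ('b \<Rightarrow> int) \<Rightarrow> bool" where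
  "optimal_flow D S T w \<xi> \<longleftrightarrow> is_arg_min (msf_cost D S T w) (msf_feasible D S T w) \<xi>"

definition potential_conditions ::
    "('a, 'b) pre_digraph \<Rightarrow> 'a set \<Rightarrow> 'a set \<Rightarrow> ('b \<Rightarrow> int) \<Rightarrow> ('b \<Rightarrow> int) \<Rightarrow>
     ('a \<Rightarrow> int) \<Rightarrow> ('a \<Rightarrow> int) \<Rightarrow> bool" where
  "potential_conditions D S T w \<xi> p q \<longleftrightarrow>
     (\<forall>a \<in> arcs_between D S T.
        (\<xi> a = 1 \<longrightarrow> w a + p (tail D a) - q (head D a) \<le> 0) \<and>
        (\<xi> a = 0 \<longrightarrow> w a + p (tail D a) - q (head D a) \<ge> 0)) \<and>
     is_arg_min (g_S_shift D S w p) (nonneg_on S) (boundary D S T \<xi>) \<and>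
     is_arg_min (g_T_shift D T w q) (nonneg_on T) (\<lambda>v. - boundary D S T \<xi> v)"

text \<open>The new root is \<open>None\<close> and an original vertex \<open>v\<close> is \<open>Some v\<close>; the new arc joining \<open>v\<close> and the
  root is \<open>Inl v\<close> and an original arc \<open>a\<close> is \<open>Inr a\<close>.\<close>

definition D_T :: "('a, 'b) pre_digraph \<Rightarrow> 'a set \<Rightarrow> ('a option, 'a + 'b) pre_digraph" where
  "D_T D T = \<lparr>verts = insert None (Some ` T), arcs = Inl ` T \<union> Inr ` arcs (D \<restriction> T),
     tail = case_sum (\<lambda>v. None) (\<lambda>a. Some (tail D a)),
     head = case_sum (\<lambda>v. Some v) (\<lambda>a. Some (head D a))\<rparr>"

definition D_S :: "('a, 'b) pre_digraph \<Rightarrow> 'a set \<Rightarrow> ('a option, 'a + 'b) pre_digraph" where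
  "D_S D S = \<lparr>verts = insert None (Some ` S), arcs = Inl ` S \<union> Inr ` arcs (D \<restriction> S),
     tail = case_sum (\<lambda>u. Some u) (\<lambda>a. Some (tail D a)),
     head = case_sum (\<lambda>u. None) (\<lambda>a. Some (head D a))\<rparr>"

definition w_T :: "('b \<Rightarrow> int) \<Rightarrow> ('a \<Rightarrow> int) \<Rightarrow> 'a + 'b \<Rightarrow> int" where
  "w_T w q = case_sum q w"

definition w_S :: "('b \<Rightarrow> int) \<Rightarrow> ('a \<Rightarrow> int) \<Rightarrow> 'a + 'b \<Rightarrow> int" where
  "w_S w p = case_sum (\<lambda>u. - p u) w"

definition big_subsets :: "'a set \<Rightarrow> 'a set set" where
  "big_subsets X = {X'. X' \<subseteq> X \<and> card X' \<ge> 2}"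

definition nonempty_subsets :: "'a set \<Rightarrow> 'a set set" where
  "nonempty_subsets X = {X'. X' \<subseteq> X \<and> X' \<noteq> {}}"

text \<open>The same objective serves both rooted duals. The variables of singletons are free in sign.
  The constraint of an arc entering (leaving) \<open>v\<close> always contains the variable of \<open>{v}\<close>; this agrees with
  membership in the cut of \<open>{v}\<close> only because loops are excluded.\<close>

definition rooted_dual_obj :: "'a set \<Rightarrow> ('a set \<Rightarrow> real) \<Rightarrow> real" where
  "rooted_dual_obj X \<rho> = (\<Sum>v\<in>X. \<rho> {v}) + (\<Sum>X'\<in>big_subsets X. \<rho> X')"

definition dual_T_feasible ::
    "('a, 'b) pre_digraph \<Rightarrow> 'a set \<Rightarrow> ('b \<Rightarrow> int) \<Rightarrow> ('a \<Rightarrow> int) \<Rightarrow> ('a set \<Rightarrow> real) \<Rightarrow> bool" where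
  "dual_T_feasible D T w q \<rho> \<longleftrightarrow>
     (\<forall>a \<in> arcs (D_T D T). \<forall>v \<in> T. head (D_T D T) a = Some v \<longrightarrow>
        \<rho> {v} + (\<Sum>T' | T' \<in> big_subsets T \<and> a \<in> cut_in (D_T D T) (Some ` T'). \<rho> T')
          \<le> of_int (w_T w q a)) \<and>
     (\<forall>T' \<in> big_subsets T. \<rho> T' \<ge> 0)"

definition dual_S_feasible ::
    "('a, 'b) pre_digraph \<Rightarrow> 'a set \<Rightarrow> ('b \<Rightarrow> int) \<Rightarrow> ('a \<Rightarrow> int) \<Rightarrow> ('a set \<Rightarrow> real) \<Rightarrow> bool" where
  "dual_S_feasible D S w p \<pi> \<longleftrightarrow>
     (\<forall>a \<in> arcs (D_S D S). \<forall>u \<in> S. tail (D_S D S) a = Some u \<longrightarrow>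
        \<pi> {u} + (\<Sum>S' | S' \<in> big_subsets S \<and> a \<in> cut_out (D_S D S) (Some ` S'). \<pi> S')
          \<le> of_int (w_S w p a)) \<and>
     (\<forall>S' \<in> big_subsets S. \<pi> S' \<ge> 0)"

definition primal_feasible ::
    "('a, 'b) pre_digraph \<Rightarrow> 'a set \<Rightarrow> 'a set \<Rightarrow> ('b \<Rightarrow> real) \<Rightarrow> bool" where
  "primal_feasible D S T x \<longleftrightarrow>
     (\<forall>S' \<in> nonempty_subsets S. (\<Sum>a\<in>cut_out D S'. x a) \<ge> 1) \<and>
     (\<forall>T' \<in> nonempty_subsets T. (\<Sum>a\<in>cut_in D T'. x a) \<ge> 1) \<and>
     (\<forall>a \<in> arcs D. x a \<ge> 0)"

definition primal_obj :: "('a, 'b) pre_digraph \<Rightarrow> ('b \<Rightarrow> int) \<Rightarrow> ('b \<Rightarrow> real) \<Rightarrow> real" where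
  "primal_obj D w x = (\<Sum>a\<in>arcs D. of_int (w a) * x a)"

definition dual_feasible ::
    "('a, 'b) pre_digraph \<Rightarrow> 'a set \<Rightarrow> 'a set \<Rightarrow> ('b \<Rightarrow> int) \<Rightarrow>
     ('a set \<Rightarrow> real) \<times> ('a set \<Rightarrow> real) \<Rightarrow> bool" where
  "dual_feasible D S T w = (\<lambda>(y, z).
     (\<forall>a \<in> arcs D.
        (\<Sum>S' | S' \<in> nonempty_subsets S \<and> a \<in> cut_out D S'. y S')
        + (\<Sum>T' | T' \<in> nonempty_subsets T \<and> a \<in> cut_in D T'. z T') \<le> of_int (w a)) \<and>
     (\<forall>S' \<in> nonempty_subsets S. y S' \<ge> 0) \<and> (\<forall>T' \<in> nonempty_subsets T. z T' \<ge> 0))"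

definition dual_obj ::
    "'a set \<Rightarrow> 'a set \<Rightarrow> ('a set \<Rightarrow> real) \<times> ('a set \<Rightarrow> real) \<Rightarrow> real" where
  "dual_obj S T = (\<lambda>(y, z). (\<Sum>S'\<in>nonempty_subsets S. y S') + (\<Sum>T'\<in>nonempty_subsets T. z T'))"

end

theory Submission
  imports Defs
begin

text \<open>
  By tightness \<open>F\<close> has weight \<open>\<Sum>\<^sub>T q(v)\<zeta>(v) - \<Sum>\<^sub>S p(u)\<eta>(u)\<close>, where \<open>\<eta>\<close> and \<open>\<zeta>\<close> are \<open>\<partial>\<xi>\<close> on \<open>S\<close> and \<open>-\<partial>\<xi>\<close> on \<open>T\<close>.
  Hence the weight of \<open>x\<^sup>*\<close> splits into the minima of \<open>g\<^sub>S[-p]\<close> and \<open>g\<^sub>T[+q]\<close>. Comparing with the 0/1 vector of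
  the roots of an arbitrary branching shows that these minima are at most the minimum weights of
  (reversed) arborescences, which by Fulkerson's min-max theorem are at most the values of the rooted
  duals. So the value of \<open>x\<^sup>*\<close> is at most that of \<open>(y\<^sup>*, z\<^sup>*)\<close>, and weak duality finishes the proof. The
  \<open>S\<close>-side is the \<open>T\<close>-side of the reversed digraph with \<open>q = -p\<close>.
\<close>

subsection \<open>Branchings and rooted arborescences\<close>

text \<open>Parallel arcs collapse to one pair, which is harmless because the relation serves to
  express absence of cycles.\<close>

definition ends :: "('a, 'b) pre_digraph \<Rightarrow> 'b set \<Rightarrow> 'a rel" where
  "ends G B = (\<lambda>a. (tail G a, head G a)) ` B"

text \<open>The digraph \<open>H\<close> with arc set \<open>B\<close> has exactly the walks of
  \<open>G\<close> that stay in \<open>B\<close>, and a nonempty closed walk always contains a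
  cycle.\<close>

lemma cycle_free_iff_acyclic:
  assumes "wf_digraph G" "B \<subseteq> arcs G"
  shows "\<not> (\<exists>c. pre_digraph.cycle G c \<and> set c \<subseteq> B) \<longleftrightarrow> acyclic (ends G B)"
proof -
  interpret G: wf_digraph G by fact
  define H where "H = G\<lparr>arcs := B\<rparr>"
  have H: "verts H = verts G" "arcs H = B" "tail H = tail G" "head H = head G"
    by (simp_all add: H_def)
  interpret H: wf_digraph H
    using assms(2) by unfold_locales (auto simp: H)
  have comp: "compatible H G" by (simp add: compatible_def H)
  have arcs_ends: "arcs_ends H = ends G B"
    by (simp add: arcs_ends_def arc_to_ends_def ends_def H)
  have awalk: "H.awalk u p v \<longleftrightarrow> G.awalk u p v \<and> set p \<subseteq> B" for u p v
    using assms(2) by (auto simp: H.awalk_def G.awalk_def H compatible_cas[OF comp])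
  have cycle: "H.cycle c \<longleftrightarrow> G.cycle c \<and> set c \<subseteq> B" for c
    by (auto simp: H.cycle_def G.cycle_def awalk compatible_awalk_verts[OF comp])
  have "(\<exists>c. H.cycle c) \<longleftrightarrow> (\<exists>u. u \<rightarrow>\<^sup>+\<^bsub>H\<^esub> u)"
  proof
    assume "\<exists>c. H.cycle c"
    then show "\<exists>u. u \<rightarrow>\<^sup>+\<^bsub>H\<^esub> u" unfolding H.cycle_def H.reachable1_awalk by blast
  next
    assume "\<exists>u. u \<rightarrow>\<^sup>+\<^bsub>H\<^esub> u"
    then have "\<exists>p. H.closed_w p" unfolding H.closed_w_def H.reachable1_awalk by auto
    then show "\<exists>c. H.cycle c" using H.closed_w_imp_cycle by blast
  qed
  then show ?thesis unfolding acyclic_def by (simp add: cycle arcs_ends)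
qed

text \<open>For finitely many arcs, acyclicity is well-foundedness. The latter is easy to carry
  through unions and insertions, and it supplies minimal vertices.\<close>

lemma branching_iff_wf:
  assumes "wf_digraph G" "finite (arcs G)"
  shows "branching G B \<longleftrightarrow> B \<subseteq> arcs G \<and> wf (ends G B) \<and> inj_on (head G) B"
proof -
  have "acyclic (ends G B) \<longleftrightarrow> wf (ends G B)" if "B \<subseteq> arcs G"
    using that finite_subset[OF that assms(2)]
    by (auto intro: wf_acyclic finite_acyclic_wf simp: ends_def)
  then show ?thesis
    using cycle_free_iff_acyclic[OF assms(1)] by (auto simp: branching_def)
qed

lemma wf_digraph_D_T: "wf_digraph (D_T D T)"
  by unfold_locales (auto simp: D_T_def)

lemma finite_arcs_D_T:
  assumes "finite (arcs D)" "finite T"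
  shows "finite (arcs (D_T D T))"
  using assms by (simp add: D_T_def)

text \<open>Deleting the root leaves a branching. The root arcs must lead precisely to its unentered
  vertices, because each vertex of \<open>T\<close> is entered exactly once. Every set of arcs
  splits into \<open>P\<close> and \<open>C\<close> in this way.\<close>

lemma arborescence_D_T_iff:
  assumes "fin_digraph D" "finite T"
  shows "arborescence (D_T D T) None (Inl ` P \<union> Inr ` C) \<longleftrightarrow>
    branching (D \<restriction> T) C \<and> P = unentered (D \<restriction> T) C"
proof -
  interpret fin_digraph D by fact
  let ?B = "Inl ` P \<union> Inr ` C"
  have "wf_digraph (D \<restriction> T)" by (rule wellformed_induce_subgraph)
  moreover have "finite (arcs (D \<restriction> T))" by simp
  ultimately have br: "branching (D \<restriction> T) B \<longleftrightarrow>
      B \<subseteq> arcs (D \<restriction> T) \<and> wf (ends (D \<restriction> T) B) \<and> inj_on (head (D \<restriction> T)) B" for B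
    by (rule branching_iff_wf)
  have br_T: "branching (D_T D T) B \<longleftrightarrow>
      B \<subseteq> arcs (D_T D T) \<and> wf (ends (D_T D T) B) \<and> inj_on (head (D_T D T)) B" for B
    by (rule branching_iff_wf) (simp_all add: wf_digraph_D_T finite_arcs_D_T assms(2))
  have ends_eq: "ends (D_T D T) ?B =
      (\<lambda>v. (None, Some v)) ` P \<union> map_prod Some Some ` ends (D \<restriction> T) C"
    by (simp add: ends_def D_T_def image_Un image_image)
  have wf_eq: "wf (ends (D_T D T) ?B) \<longleftrightarrow> wf (ends (D \<restriction> T) C)"
  proof
    assume "wf (ends (D_T D T) ?B)"
    then have "wf (inv_image (ends (D_T D T) ?B) Some)" by simp
    then show "wf (ends (D \<restriction> T) C)"
      by (rule wf_subset) (force simp: ends_eq inv_image_def)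
  next
    assume "wf (ends (D \<restriction> T) C)"
    then have "wf (map_prod Some Some ` ends (D \<restriction> T) C)"
      by (rule wf_map_prod_image) auto
    moreover have "wf ((\<lambda>v. (None, Some v)) ` P)"
      by (rule wf_subset[of "measure (\<lambda>v. if v = None then 0 else 1)"]) auto
    \<comment> \<open>No arc enters \<open>None\<close>, so the root arcs can be adjoined without
      closing a cycle.\<close>
    ultimately show "wf (ends (D_T D T) ?B)"
      unfolding ends_eq by (intro wf_Un) auto
  qed
  have sub: "?B \<subseteq> arcs (D_T D T) \<longleftrightarrow> P \<subseteq> T \<and> C \<subseteq> arcs (D \<restriction> T)"
    by (auto simp: D_T_def)
  have inj: "inj_on (head (D_T D T)) ?B \<longleftrightarrow> inj_on (head (D \<restriction> T)) C \<and> P \<inter> head D ` C = {}"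
  proof -
    have "Inl ` P - Inr ` C = Inl ` P" "Inr ` C - Inl ` P = Inr ` C" by auto
    moreover have "head (D_T D T) ` Inl ` P = Some ` P"
        "head (D_T D T) ` Inr ` C = Some ` head D ` C"
      by (simp_all add: D_T_def image_image)
    moreover have "inj_on (head (D_T D T)) (Inl ` P)"
        "inj_on (head (D_T D T)) (Inr ` C) \<longleftrightarrow> inj_on (head (D \<restriction> T)) C"
      by (simp_all add: inj_on_def D_T_def)
    ultimately show ?thesis by (auto simp: inj_on_Un)
  qed
  define cover where
    "cover \<longleftrightarrow> (\<forall>v\<in>verts (D_T D T). v \<noteq> None \<longrightarrow> in_arcs (D_T D T) v \<inter> ?B \<noteq> {})"
  have cover: "cover \<longleftrightarrow> T \<subseteq> P \<union> head D ` C" if "P \<subseteq> T" "C \<subseteq> arcs (D \<restriction> T)"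
  proof -
    have "in_arcs (D_T D T) (Some v) \<inter> ?B = Inl ` ({v} \<inter> P) \<union> Inr ` {a \<in> C. head D a = v}" for v
      using that by (auto simp: D_T_def in_arcs_def)
    moreover have "verts (D_T D T) = insert None (Some ` T)" by (simp add: D_T_def)
    ultimately show ?thesis by (auto simp: cover_def)
  qed
  have un: "unentered (D \<restriction> T) C = T - head D ` C" if "C \<subseteq> arcs (D \<restriction> T)"
    using that by (auto simp: unentered_def in_arcs_def)
  have "arborescence (D_T D T) None ?B \<longleftrightarrow> P \<subseteq> T \<and> C \<subseteq> arcs (D \<restriction> T) \<and> wf (ends (D \<restriction> T) C) \<and>
      inj_on (head (D \<restriction> T)) C \<and> P \<inter> head D ` C = {} \<and> T \<subseteq> P \<union> head D ` C"
    unfolding arborescence_def br_T sub wf_eq inj cover_def[symmetric] using cover by blast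
  also have "\<dots> \<longleftrightarrow> branching (D \<restriction> T) C \<and> P = unentered (D \<restriction> T) C"
  proof -
    have "P \<subseteq> T \<and> P \<inter> head D ` C = {} \<and> T \<subseteq> P \<union> head D ` C \<longleftrightarrow> P = T - head D ` C"
      by blast
    then show ?thesis unfolding br using un by metis
  qed
  finally show ?thesis .
qed

subsection \<open>The min-max theorem for arborescences\<close>

lemma cut_in_iff: "a \<in> cut_in G X \<longleftrightarrow> a \<in> arcs G \<and> tail G a \<notin> X \<and> head G a \<in> X"
  by (simp add: cut_in_def)

text \<open>With \<open>U\<close> the non-root vertices of \<open>D_T\<close>, these are the arc
  sets that contain an arborescence. As a family closed under supersets they are easier to modify
  than arborescences themselves.\<close>

definition covers :: "('a, 'b) pre_digraph \<Rightarrow> 'a set \<Rightarrow> 'b set \<Rightarrow> bool" where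
  "covers G U B \<longleftrightarrow> (\<forall>X \<in> nonempty_subsets U. cut_in G X \<inter> B \<noteq> {})"

text \<open>Uncrossing. Think of \<open>Z\<close> as the tight arcs and of \<open>X\<close> as a minimal set that no tight arc enters, so that
  \<open>Z\<close> connects \<open>X\<close> strongly. The arc \<open>e\<close> is one through which \<open>X\<close> is reached from outside without
  passing through \<open>X\<close> before; the set \<open>W\<close> in the proof collects the vertices reached only via \<open>X\<close>.\<close>

lemma cover_reduce:
  assumes cov: "covers G U B'" and X: "X \<in> nonempty_subsets U"
    and Z: "cut_in G X \<inter> Z = {}"
    and X_min: "\<And>Y. Y \<subset> X \<Longrightarrow> Y \<noteq> {} \<Longrightarrow> cut_in G Y \<inter> Z \<noteq> {}"
  obtains e where "e \<in> B' \<inter> cut_in G X" "covers G U ((B' - cut_in G X) \<union> Z \<union> {e})"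
proof -
  \<comment> \<open>A good set is one that arcs of \<open>B'\<close> enter only from
    \<open>X\<close>. Goodness is preserved by unions, so \<open>W\<close> is the largest good
    set.\<close>
  define good where
    "good W \<longleftrightarrow> W \<subseteq> U - X \<and> (\<forall>a\<in>cut_in G W \<inter> B'. tail G a \<in> X)" for W
  define W where "W = \<Union>{W. good W}"
  have W: "good W"
    unfolding good_def
  proof (intro conjI ballI)
    show "W \<subseteq> U - X" by (auto simp: good_def W_def)
    fix a assume a: "a \<in> cut_in G W \<inter> B'"
    then obtain W' where "good W'" "head G a \<in> W'" "tail G a \<notin> W'"
      by (auto simp: W_def cut_in_iff)
    then show "tail G a \<in> X" using a by (auto simp: good_def cut_in_iff)
  qed
  have "X \<union> W \<in> nonempty_subsets U"
    using X W by (auto simp: nonempty_subsets_def good_def)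
  then obtain e where e: "e \<in> cut_in G (X \<union> W)" "e \<in> B'"
    using cov unfolding covers_def by blast
  \<comment> \<open>If the head of \<open>e\<close> were in \<open>W\<close>, goodness would put its
    tail into \<open>X\<close>.\<close>
  have e_head: "head G e \<in> X"
    using e W by (auto simp: good_def cut_in_iff)
  show ?thesis
  proof (rule that)
    show "e \<in> B' \<inter> cut_in G X" using e e_head by (auto simp: cut_in_iff)
    show "covers G U ((B' - cut_in G X) \<union> Z \<union> {e})"
      unfolding covers_def
    proof (rule ballI, rule notI)
      fix Y assume Y: "Y \<in> nonempty_subsets U"
        and none: "cut_in G Y \<inter> ((B' - cut_in G X) \<union> Z \<union> {e}) = {}"
      show False
      proof (cases "X \<subseteq> Y \<or> X \<inter> Y = {}")
        \<comment> \<open>\<open>X\<close> and \<open>Y\<close> cross or \<open>Y\<close> lies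
          strictly inside \<open>X\<close>. A \<open>Z\<close>-arc into \<open>X \<inter> Y\<close>
          does not enter \<open>X\<close>, so its tail is in \<open>X\<close> and it enters
          \<open>Y\<close>.\<close>
        case False
        then have "X \<inter> Y \<subset> X" "X \<inter> Y \<noteq> {}" by auto
        from X_min[OF this] obtain a where "a \<in> cut_in G (X \<inter> Y)" "a \<in> Z" by blast
        then show False using none Z by (auto simp: cut_in_iff)
      next
        case True
        then show False
        proof
          \<comment> \<open>An arc of \<open>B'\<close> into \<open>Y\<close> has its head outside
            \<open>X\<close>, so it was not removed.\<close>
          assume "X \<inter> Y = {}"
          moreover obtain a where "a \<in> cut_in G Y" "a \<in> B'"
            using cov Y unfolding covers_def by blast
          ultimately have "a \<in> cut_in G Y \<inter> (B' - cut_in G X)" by (auto simp: cut_in_iff)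
          then show False using none by blast
        next
          assume XY: "X \<subseteq> Y"
          then have s: "tail G e \<in> Y" using none e e_head by (auto simp: cut_in_iff)
          \<comment> \<open>Since \<open>e\<close> does not enter \<open>Y\<close>, its tail lies in
            \<open>Y - X\<close>. Goodness of the enlarged set forces \<open>Y - X\<close> into
            \<open>W\<close>, whereas the tail of \<open>e\<close> avoids \<open>W\<close>.\<close>
          have "good (W \<union> (Y - X))"
            unfolding good_def
          proof (intro conjI ballI)
            show "W \<union> (Y - X) \<subseteq> U - X"
              using W Y by (auto simp: good_def nonempty_subsets_def)
            fix a assume a: "a \<in> cut_in G (W \<union> (Y - X)) \<inter> B'"
            show "tail G a \<in> X"
            proof (rule ccontr)
              assume nt: "tail G a \<notin> X"
              show False
              proof (cases "head G a \<in> W")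
                case True
                then show False using a W nt by (auto simp: good_def cut_in_iff)
              next
                case False
                then have "a \<in> cut_in G Y \<inter> (B' - cut_in G X)"
                  using a nt by (auto simp: cut_in_iff)
                then show False using none by blast
              qed
            qed
          qed
          then have "Y - X \<subseteq> W" by (auto simp: W_def)
          then show False using s e by (auto simp: cut_in_iff)
        qed
      qed
    qed
  qed
qed

text \<open>Dual ascent: raise the variable of a minimal set \<open>X\<close> not entered by a tight arc until some arc entering
  \<open>X\<close> becomes tight. A cover for the reduced costs is then altered to enter \<open>X\<close> just once.\<close>

lemma cover_dual_nonneg:
  fixes c :: "'b \<Rightarrow> real"
  assumes U: "finite U" and A: "finite (arcs G)" and cov: "covers G U (arcs G)"
    and c: "\<forall>a\<in>arcs G. c a \<ge> 0"
  shows "\<exists>B \<rho>. B \<subseteq> arcs G \<and> covers G U B \<and> (\<forall>X. \<rho> X \<ge> 0) \<and>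
    (\<forall>a\<in>arcs G. (\<Sum>X | X \<in> nonempty_subsets U \<and> a \<in> cut_in G X. \<rho> X) \<le> c a) \<and>
    sum c B \<le> sum \<rho> (nonempty_subsets U)"
  using c
proof (induction "card {a \<in> arcs G. c a > 0}" arbitrary: c rule: less_induct)
  case less
  define Z where "Z = {a \<in> arcs G. c a = 0}"
  have fin: "finite (nonempty_subsets U)"
    using U by (simp add: nonempty_subsets_def)
  show ?case
  proof (cases "covers G U Z")
    case True
    then show ?thesis using less.prems
      by (intro exI[of _ Z] exI[of _ "\<lambda>_. 0"]) (auto simp: Z_def)
  next
    case False
    define \<X> where "\<X> = {X \<in> nonempty_subsets U. cut_in G X \<inter> Z = {}}"
    have "finite \<X>" "\<X> \<noteq> {}" using False fin by (auto simp: \<X>_def covers_def)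
    then obtain X where "X \<in> \<X>" and min: "\<And>Y. Y \<in> \<X> \<Longrightarrow> Y \<subseteq> X \<Longrightarrow> X = Y"
      by (meson finite_has_minimal)
    then have X: "X \<in> nonempty_subsets U" and XZ: "cut_in G X \<inter> Z = {}"
      by (auto simp: \<X>_def)
    have X_min: "cut_in G Y \<inter> Z \<noteq> {}" if "Y \<subset> X" "Y \<noteq> {}" for Y
      using min[of Y] that X by (auto simp: \<X>_def nonempty_subsets_def)
    have cutX: "finite (cut_in G X)" "cut_in G X \<noteq> {}" "cut_in G X \<subseteq> arcs G"
      using A cov X by (auto simp: cut_in_def covers_def)
    \<comment> \<open>The cut is nonempty because the set of all arcs is a cover, so the minimum
      exists. It is positive because no tight arc enters \<open>X\<close>.\<close>
    define \<epsilon> where "\<epsilon> = Min (c ` cut_in G X)"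
    have \<epsilon>_le: "\<epsilon> \<le> c a" if "a \<in> cut_in G X" for a
      using that cutX by (simp add: \<epsilon>_def)
    have "\<epsilon> \<in> c ` cut_in G X" unfolding \<epsilon>_def using cutX by (intro Min_in) auto
    then obtain a0 where a0: "a0 \<in> cut_in G X" "c a0 = \<epsilon>" by blast
    have \<epsilon>: "\<epsilon> > 0"
      using a0 XZ cutX bspec[OF less.prems, of a0] by (auto simp: Z_def order_le_less)
    define c' where "c' a = c a - (if a \<in> cut_in G X then \<epsilon> else 0)" for a
    have c'_nonneg: "\<forall>a\<in>arcs G. c' a \<ge> 0"
      using less.prems \<epsilon>_le by (simp add: c'_def)
    \<comment> \<open>The minimizing arc \<open>a0\<close> becomes tight, and reduced costs never
      increase, so the induction measure drops.\<close>
    have "{a \<in> arcs G. c' a > 0} \<subset> {a \<in> arcs G. c a > 0}"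
      using a0 \<epsilon> cutX by (auto simp: c'_def split: if_splits)
    then have "card {a \<in> arcs G. c' a > 0} < card {a \<in> arcs G. c a > 0}"
      using A by (intro psubset_card_mono) auto
    from less.hyps[OF this c'_nonneg] obtain B' \<rho>' where B': "B' \<subseteq> arcs G" "covers G U B'"
      and \<rho>': "\<And>X. \<rho>' X \<ge> 0"
        "\<And>a. a \<in> arcs G \<Longrightarrow> (\<Sum>X | X \<in> nonempty_subsets U \<and> a \<in> cut_in G X. \<rho>' X) \<le> c' a"
        "sum c' B' \<le> sum \<rho>' (nonempty_subsets U)"
      by blast
    obtain e where e: "e \<in> B' \<inter> cut_in G X" "covers G U ((B' - cut_in G X) \<union> Z \<union> {e})"
      using cover_reduce[OF B'(2) X XZ X_min] by blast
    define B where "B = (B' - cut_in G X) \<union> Z \<union> {e}"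
    define \<rho> where "\<rho> = \<rho>'(X := \<rho>' X + \<epsilon>)"
    have BA: "B \<subseteq> arcs G" using B' e by (auto simp: B_def Z_def)
    have finB: "finite B" "finite B'" using BA B' A finite_subset by blast+
    have "c = (\<lambda>a. c' a + (if a \<in> cut_in G X then \<epsilon> else 0))" by (auto simp: c'_def)
    then have "sum c B = sum c' B + sum (\<lambda>a. if a \<in> cut_in G X then \<epsilon> else 0) B"
      by (metis (no_types, lifting) sum.cong sum.distrib)
    also have "sum (\<lambda>a. if a \<in> cut_in G X then \<epsilon> else 0) B = sum (\<lambda>a. \<epsilon>) (B \<inter> cut_in G X)"
      by (simp only: sum.inter_restrict[OF finB(1)])
    \<comment> \<open>Entering \<open>X\<close> once is what makes the added cost exactly
      \<epsilon>, the same amount by which the dual value grows.\<close>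
    also have "B \<inter> cut_in G X = {e}" using e XZ by (auto simp: B_def)
    also have "sum c' B \<le> sum c' B'"
    proof -
      \<comment> \<open>Arcs of \<open>B\<close> outside \<open>B'\<close> are tight and do not
        enter \<open>X\<close>, so their reduced cost is still zero.\<close>
      have "sum c' B = sum c' (B \<inter> B')"
        using finB XZ e(1) by (intro sum.mono_neutral_right) (auto simp: B_def Z_def c'_def)
      also have "\<dots> \<le> sum c' B'"
        using finB B' by (intro sum_mono2) (use c'_nonneg in auto)
      finally show ?thesis .
    qed
    finally have "sum c B \<le> sum \<rho>' (nonempty_subsets U) + \<epsilon>" using \<rho>'(3) by simp
    also have "\<dots> = sum \<rho> (nonempty_subsets U)"
      using fin X by (simp add: \<rho>_def sum.remove[of _ X])
    finally have cost: "sum c B \<le> sum \<rho> (nonempty_subsets U)" .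
    have "(\<Sum>X | X \<in> nonempty_subsets U \<and> a \<in> cut_in G X. \<rho> X) \<le> c a" if a: "a \<in> arcs G" for a
    proof -
      let ?Y = "{Y \<in> nonempty_subsets U. a \<in> cut_in G Y}"
      have finY: "finite ?Y" using fin by simp
      have "sum \<rho> ?Y = sum \<rho>' ?Y + (if a \<in> cut_in G X then \<epsilon> else 0)"
      proof (cases "a \<in> cut_in G X")
        case True
        then show ?thesis using finY X by (simp add: \<rho>_def sum.remove[of _ X])
      next
        case False
        then have "sum \<rho> ?Y = sum \<rho>' ?Y" by (intro sum.cong) (auto simp: \<rho>_def)
        then show ?thesis using False by simp
      qed
      also have "\<dots> \<le> c a" using \<rho>'(2)[OF a] by (simp add: c'_def)
      finally show ?thesis .
    qed
    moreover have "\<rho> X \<ge> 0" for X using \<rho>'(1) \<epsilon> by (simp add: \<rho>_def add_nonneg_nonneg)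
    ultimately show ?thesis using BA cost e(2) unfolding B_def[symmetric] by blast
  qed
qed

text \<open>Grow a branching from outside \<open>U\<close>: as long as a vertex of \<open>U\<close>
  is unreached, the cover has an arc into the set of unreached vertices, and this arc can be
  added.\<close>

lemma cover_contains_spanning_branching:
  assumes "wf_digraph G" "finite (arcs G)" and B: "B \<subseteq> arcs G" "covers G U B"
  obtains C where "C \<subseteq> B" "branching G C" "head G ` C = U"
proof -
  \<comment> \<open>The last clause says that arcs start outside \<open>U\<close> or at a vertex
    already reached. Hence unreached vertices have no outgoing arc in \<open>C\<close>, and adding
    an arc into one of them closes no cycle.\<close>
  define good where "good C \<longleftrightarrow> C \<subseteq> B \<and> branching G C \<and> head G ` C \<subseteq> U \<and>
    tail G ` C \<inter> U \<subseteq> head G ` C" for C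
  note br = branching_iff_wf[OF assms(1,2)]
  have "good {}" by (simp add: good_def br ends_def)
  moreover have "finite {C. good C}"
    using finite_subset[OF B(1) assms(2)]
    by (intro finite_subset[of "{C. good C}" "Pow B"]) (auto simp: good_def)
  ultimately obtain C where "C \<in> {C. good C}" and max: "\<forall>C'\<in>{C. good C}. C \<subseteq> C' \<longrightarrow> C = C'"
    using finite_has_maximal[of "{C. good C}"] by blast
  then have C: "good C" by simp
  have "head G ` C = U"
  proof (rule ccontr)
    assume "head G ` C \<noteq> U"
    then have "U - head G ` C \<in> nonempty_subsets U"
      using C by (auto simp: good_def nonempty_subsets_def)
    then have "cut_in G (U - head G ` C) \<inter> B \<noteq> {}"
      using B(2) by (simp add: covers_def)
    then obtain a where "a \<in> cut_in G (U - head G ` C) \<inter> B" by blast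
    then have a: "a \<in> B" "tail G a \<notin> U - head G ` C" "head G a \<in> U" "head G a \<notin> head G ` C"
      by (simp_all add: cut_in_iff)
    have "(head G a, tail G a) \<notin> (ends G C)\<^sup>*"
    proof
      assume "(head G a, tail G a) \<in> (ends G C)\<^sup>*"
      moreover have "head G a \<noteq> tail G a" using a by auto
      ultimately obtain y where "(head G a, y) \<in> ends G C"
        by (meson converse_rtranclE)
      then obtain b where "b \<in> C" "tail G b = head G a"
        unfolding ends_def by auto
      then have "head G a \<in> tail G ` C \<inter> U" using a(3) by (auto intro: image_eqI[OF sym])
      then show False using a(4) C by (auto simp: good_def)
    qed
    then have "wf (ends G (insert a C))"
      using C by (simp add: ends_def good_def br)
    then have "good (insert a C)"
      using C a B(1) by (auto simp: good_def br)
    then show False using max a by blast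
  qed
  then show ?thesis using that C unfolding good_def by blast
qed

section \<open>Rooted duals as sums over all nonempty vertex sets\<close>

lemma finite_nonempty_subsets [simp]: "finite X \<Longrightarrow> finite (nonempty_subsets X)"
  by (simp add: nonempty_subsets_def)

lemma nonempty_subsets_eq:
  assumes "finite X"
  shows "nonempty_subsets X = (\<lambda>v. {v}) ` X \<union> big_subsets X"
proof (rule equalityI)
  show "nonempty_subsets X \<subseteq> (\<lambda>v. {v}) ` X \<union> big_subsets X"
  proof
    fix Y assume Y: "Y \<in> nonempty_subsets X"
    then have "finite Y" "Y \<noteq> {}" using assms by (auto simp: nonempty_subsets_def finite_subset)
    then have "card Y = 1 \<or> card Y \<ge> 2" using card_gt_0_iff[of Y] by linarith
    then show "Y \<in> (\<lambda>v. {v}) ` X \<union> big_subsets X"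
      using Y by (auto simp: nonempty_subsets_def big_subsets_def card_1_singleton_iff)
  qed
qed (auto simp: nonempty_subsets_def big_subsets_def)

lemma rooted_dual_obj_eq:
  assumes "finite X"
  shows "rooted_dual_obj X \<rho> = sum \<rho> (nonempty_subsets X)"
proof -
  have "(\<lambda>v. {v}) ` X \<inter> big_subsets X = {}" by (auto simp: big_subsets_def)
  moreover have "finite (big_subsets X)" using assms by (simp add: big_subsets_def)
  ultimately show ?thesis
    using assms by (simp add: nonempty_subsets_eq rooted_dual_obj_def sum.union_disjoint sum.reindex)
qed

text \<open>In the absence of loops an arc with head \<open>v\<close> enters the singleton of
  \<open>v\<close> and no other singleton, so the separate singleton variable merges into the sum
  over cuts.\<close>

lemma dual_T_feasible_iff:
  assumes "loopfree_digraph D" "finite T"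
  shows "dual_T_feasible D T w q \<rho> \<longleftrightarrow>
    (\<forall>a \<in> arcs (D_T D T).
      (\<Sum>T' | T' \<in> nonempty_subsets T \<and> a \<in> cut_in (D_T D T) (Some ` T'). \<rho> T') \<le> of_int (w_T w q a)) \<and>
    (\<forall>T' \<in> big_subsets T. \<rho> T' \<ge> 0)"
proof -
  have eq: "\<rho> {v} + (\<Sum>T' | T' \<in> big_subsets T \<and> a \<in> cut_in (D_T D T) (Some ` T'). \<rho> T') =
      (\<Sum>T' | T' \<in> nonempty_subsets T \<and> a \<in> cut_in (D_T D T) (Some ` T'). \<rho> T')"
    if "a \<in> arcs (D_T D T)" "v \<in> T" "head (D_T D T) a = Some v" for a v
  proof -
    have "tail (D_T D T) a \<noteq> Some v"
      using that loopfree_digraph.no_loops[OF assms(1)] by (auto simp: D_T_def)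
    then have "{T' \<in> nonempty_subsets T. a \<in> cut_in (D_T D T) (Some ` T')} =
        insert {v} {T' \<in> big_subsets T. a \<in> cut_in (D_T D T) (Some ` T')}"
      using that by (auto simp: nonempty_subsets_eq[OF assms(2)] cut_in_iff)
    moreover have "finite (big_subsets T)" "{v} \<notin> big_subsets T"
      using assms(2) by (simp_all add: big_subsets_def)
    ultimately show ?thesis by simp
  qed
  have "\<exists>v\<in>T. head (D_T D T) a = Some v" if "a \<in> arcs (D_T D T)" for a
    using that by (auto simp: D_T_def)
  then show ?thesis unfolding dual_T_feasible_def using eq by (metis (no_types, lifting))
qed

text \<open>The hard direction of Fulkerson's theorem: dual ascent yields a cover no dearer than a
  dual solution, and pruning it to an arborescence does not raise the cost, as the shifted weights
  are nonnegative.\<close>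

lemma arborescence_duality:
  assumes "fin_digraph D" "loopfree_digraph D" "finite T"
  obtains B \<rho> where "arborescence (D_T D T) None B" "dual_T_feasible D T w q \<rho>"
    "of_int (\<Sum>a\<in>B. w_T w q a) \<le> rooted_dual_obj T \<rho>"
proof -
  interpret D: fin_digraph D by fact
  let ?G = "D_T D T" and ?U = "Some ` T"
  have finG: "finite (arcs ?G)" by (simp add: finite_arcs_D_T assms(3))
  have heads: "head ?G a \<in> ?U" if "a \<in> arcs ?G" for a
    using that by (auto simp: D_T_def)
  \<comment> \<open>Every arborescence has exactly one arc into each vertex of \<open>T\<close>, so a constant shift of the weights to
    nonnegative ones is absorbed by the dual variables of the singletons, which are free in sign.\<close>
  define m :: real where "m = Min (insert 0 ((\<lambda>a. of_int (w_T w q a)) ` arcs ?G))"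
  define c where "c a = of_int (w_T w q a) - m" for a
  have c: "\<forall>a\<in>arcs ?G. c a \<ge> 0"
    using finG by (simp add: c_def m_def)
  have "covers ?G ?U (arcs ?G)"
    unfolding covers_def
  proof
    fix X assume "X \<in> nonempty_subsets ?U"
    then obtain v where "v \<in> T" "Some v \<in> X" "None \<notin> X" by (auto simp: nonempty_subsets_def)
    then have "Inl v \<in> cut_in ?G X" by (auto simp: cut_in_def D_T_def)
    then show "cut_in ?G X \<inter> arcs ?G \<noteq> {}" by (auto simp: cut_in_iff)
  qed
  from cover_dual_nonneg[where c = c, OF finite_imageI[OF assms(3)] finG this c]
  obtain B \<rho>0 where B: "B \<subseteq> arcs ?G" "covers ?G ?U B"
    and \<rho>0: "\<forall>X. \<rho>0 X \<ge> 0"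
      "\<forall>a\<in>arcs ?G. (\<Sum>X | X \<in> nonempty_subsets ?U \<and> a \<in> cut_in ?G X. \<rho>0 X) \<le> c a"
      "sum c B \<le> sum \<rho>0 (nonempty_subsets ?U)"
    by (elim exE conjE)
  obtain C where C: "C \<subseteq> B" "branching ?G C" "head ?G ` C = ?U"
    using cover_contains_spanning_branching[OF wf_digraph_D_T finG B] .
  have arb: "arborescence ?G None C"
    unfolding arborescence_def
  proof (intro conjI ballI impI C(2))
    fix v assume "v \<in> verts ?G" "v \<noteq> None"
    then have "v \<in> head ?G ` C" using C(3) by (auto simp: D_T_def)
    then obtain a where "a \<in> C" "head ?G a = v" by blast
    then have "a \<in> in_arcs ?G v \<inter> C" using C(1) B(1) by auto
    then show "in_arcs ?G v \<inter> C \<noteq> {}" by blast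
  qed
  \<comment> \<open>The shift is undone on singletons only: each arc enters one singleton, so its
    constraint regains \<open>m\<close> once, and the objective regains \<open>m\<close> once per
    vertex of \<open>T\<close>.\<close>
  define \<rho> where "\<rho> X = \<rho>0 (Some ` X) + (if card X = 1 then m else 0)" for X
  have inj: "inj_on ((`) Some) A" for A :: "'a set set"
    by (intro inj_onI) (simp add: inj_image_eq_iff)
  have image: "(`) Some ` nonempty_subsets T = nonempty_subsets ?U"
    by (auto simp: nonempty_subsets_def subset_image_iff image_iff)
  have sing: "(\<Sum>X\<in>\<X>. if card X = 1 then m else 0) = m * card {v. {v} \<in> \<X>}"
    if "\<X> \<subseteq> nonempty_subsets T" for \<X>
  proof -
    have "finite \<X>" using that assms(3) finite_subset finite_nonempty_subsets by blast
    then have "(\<Sum>X\<in>\<X>. if card X = 1 then m else 0) = (\<Sum>X\<in>{X\<in>\<X>. card X = 1}. m)"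
      by (simp only: sum.inter_filter)
    also have "{X\<in>\<X>. card X = 1} = (\<lambda>v. {v}) ` {v. {v} \<in> \<X>}"
      by (auto simp: card_1_singleton_iff)
    finally show ?thesis by (simp add: card_image)
  qed
  have "dual_T_feasible D T w q \<rho>"
    unfolding dual_T_feasible_iff[OF assms(2,3)]
  proof (intro conjI ballI)
    fix a assume a: "a \<in> arcs ?G"
    let ?\<X> = "{T' \<in> nonempty_subsets T. a \<in> cut_in ?G (Some ` T')}"
    obtain v where v: "v \<in> T" "head ?G a = Some v" using heads[OF a] by blast
    have "tail ?G a \<noteq> Some v"
      using a v loopfree_digraph.no_loops[OF assms(2)] by (auto simp: D_T_def)
    then have "{v. {v} \<in> ?\<X>} = {v}"
      using a v by (auto simp: cut_in_iff nonempty_subsets_def)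
    then have "sum \<rho> ?\<X> = (\<Sum>X\<in>?\<X>. \<rho>0 (Some ` X)) + m"
      unfolding \<rho>_def sum.distrib by (subst sing) auto
    also have "(\<Sum>X\<in>?\<X>. \<rho>0 (Some ` X)) = sum \<rho>0 ((`) Some ` ?\<X>)"
      by (simp add: sum.reindex[OF inj])
    also have "(`) Some ` ?\<X> = {X \<in> nonempty_subsets ?U. a \<in> cut_in ?G X}"
      unfolding image[symmetric] by blast
    finally show "sum \<rho> ?\<X> \<le> of_int (w_T w q a)"
      using bspec[OF \<rho>0(2) a] by (simp add: c_def)
  qed (use \<rho>0(1) in \<open>auto simp: \<rho>_def big_subsets_def\<close>)
  moreover have "of_int (\<Sum>a\<in>C. w_T w q a) \<le> rooted_dual_obj T \<rho>"
  proof -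
    have finB: "finite B" using B(1) finG finite_subset by blast
    have "inj_on (head ?G) C" using C(2) by (simp add: branching_def)
    \<comment> \<open>The arborescence has \<open>card T\<close> arcs, so its weight regains the
      same multiple of \<open>m\<close> as the dual objective.\<close>
    then have card: "card C = card T" using card_image[of "head ?G" C] C(3) by (simp add: card_image)
    have "{v. {v} \<in> nonempty_subsets T} = T" by (auto simp: nonempty_subsets_def)
    then have "rooted_dual_obj T \<rho> = (\<Sum>X\<in>nonempty_subsets T. \<rho>0 (Some ` X)) + m * card T"
      unfolding rooted_dual_obj_eq[OF assms(3)] \<rho>_def sum.distrib by (subst sing) auto
    also have "(\<Sum>X\<in>nonempty_subsets T. \<rho>0 (Some ` X)) = sum \<rho>0 (nonempty_subsets ?U)"
      unfolding image[symmetric] by (simp add: sum.reindex[OF inj])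
    also have "sum c C \<le> sum c B"
      using C(1) B(1) finB c by (intro sum_mono2) auto
    ultimately show ?thesis
      using \<rho>0(3) card by (simp add: c_def sum_subtractf mult.commute)
  qed
  ultimately show ?thesis using that arb by blast
qed

subsection \<open>Minimizers of the shifted functions\<close>

lemma Inl_Un_Inr_vimage: "Inl ` (Inl -` B) \<union> Inr ` (Inr -` B) = B"
proof (rule set_eqI)
  show "b \<in> Inl ` (Inl -` B) \<union> Inr ` (Inr -` B) \<longleftrightarrow> b \<in> B" for b by (cases b) auto
qed

lemma sum_w_T:
  assumes "finite P" "finite C"
  shows "(\<Sum>a\<in>Inl ` P \<union> Inr ` C. w_T w q a) = sum q P + sum w C"
proof -
  have "Inl ` P \<inter> Inr ` C = {}" by auto
  then show ?thesis
    using assms by (simp add: sum.union_disjoint sum.reindex w_T_def)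
qed

lemma finite_branchings:
  assumes "fin_digraph D"
  shows "finite {B. branching (D \<restriction> T) B \<and> Q B}"
proof -
  interpret fin_digraph D by fact
  have "{B. branching (D \<restriction> T) B \<and> Q B} \<subseteq> Pow (arcs D)" by (auto simp: branching_def)
  then show ?thesis using finite_arcs by (simp add: finite_subset)
qed

lemma g_T_le:
  assumes "fin_digraph D" "nonneg_on T \<eta>" "branching (D \<restriction> T) C" "unentered (D \<restriction> T) C = suppp T \<eta>"
  shows "g_T D T w \<eta> \<le> ereal (of_int (sum w C))"
proof -
  let ?\<B> = "{B. branching (D \<restriction> T) B \<and> unentered (D \<restriction> T) B = suppp T \<eta>}"
  have "C \<in> ?\<B>" "finite ?\<B>" using assms finite_branchings by auto
  then have "Min (sum w ` ?\<B>) \<le> sum w C" "?\<B> \<noteq> {}" by (auto intro!: Min_le)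
  then show ?thesis using assms(2) by (simp add: g_T_def Let_def del: of_int_sum)
qed

lemma g_T_attained:
  assumes "fin_digraph D" "g_T D T w \<eta> < \<infinity>"
  obtains C where "branching (D \<restriction> T) C" "unentered (D \<restriction> T) C = suppp T \<eta>"
    "g_T D T w \<eta> = ereal (of_int (sum w C))"
proof -
  let ?\<B> = "{B. branching (D \<restriction> T) B \<and> unentered (D \<restriction> T) B = suppp T \<eta>}"
  have ne: "nonneg_on T \<eta>" "?\<B> \<noteq> {}" using assms(2) by (auto simp: g_T_def Let_def split: if_splits)
  then have "Min (sum w ` ?\<B>) \<in> sum w ` ?\<B>"
    using finite_branchings[OF assms(1)] by (intro Min_in) auto
  then obtain C where "C \<in> ?\<B>" "Min (sum w ` ?\<B>) = sum w C" by blast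
  moreover from this ne have "g_T D T w \<eta> = ereal (of_int (sum w C))"
    by (simp add: g_T_def Let_def)
  ultimately show ?thesis using that by blast
qed

text \<open>\<open>B\<close> is optimal only for its prescribed root set; optimality of \<zeta>
  extends the comparison to all arborescences. The values of \<zeta> may exceed 1, so the sum of
  \<open>q v * \<zeta> v\<close> need not be the weight of the root arcs of
  \<open>B\<close>.\<close>

lemma arborescence_le_rooted_dual:
  fixes D :: "('a, 'b) pre_digraph"
  assumes D: "fin_digraph D" "loopfree_digraph D" and T: "finite T"
    and opt: "is_arg_min (g_T_shift D T w q) (nonneg_on T) \<zeta>" and fin: "g_T D T w \<zeta> < \<infinity>"
    and B: "is_arg_min (\<lambda>B. \<Sum>a\<in>B. w_T w q a)
        (\<lambda>B. arborescence (D_T D T) None B \<and>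
             unentered (D \<restriction> T) (Inr -` B \<inter> arcs (D \<restriction> T)) = suppp T \<zeta>) B"
    and \<rho>: "is_arg_max (rooted_dual_obj T) (dual_T_feasible D T w q) \<rho>"
  shows "branching (D \<restriction> T) (Inr -` B)" (is ?th1)
    and "unentered (D \<restriction> T) (Inr -` B) = suppp T \<zeta>" (is ?th2)
    and "of_int ((\<Sum>v\<in>T. q v * \<zeta> v) + sum w (Inr -` B)) \<le> rooted_dual_obj T \<rho>" (is ?th3)
proof -
  interpret D: fin_digraph D by fact
  have arb_iff: "arborescence (D_T D T) None B' \<longleftrightarrow>
      branching (D \<restriction> T) (Inr -` B') \<and> Inl -` B' = unentered (D \<restriction> T) (Inr -` B')" for B'
    using arborescence_D_T_iff[OF D(1) T, of "Inl -` B'" "Inr -` B'"]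
    by (simp only: Inl_Un_Inr_vimage)
  have fin_br: "finite C" "C \<inter> arcs (D \<restriction> T) = C" if "branching (D \<restriction> T) C" for C
    using that D.finite_arcs finite_subset[of C "arcs D"] by (auto simp: branching_def)
  have fin_un: "finite (unentered (D \<restriction> T) C)" for C
    using T finite_subset[of "unentered (D \<restriction> T) C" T] by (auto simp: unentered_def)
  have weight: "(\<Sum>a\<in>B'. w_T w q a) = sum q (unentered (D \<restriction> T) (Inr -` B')) + sum w (Inr -` B')"
    if "arborescence (D_T D T) None B'" for B'
  proof -
    have br: "branching (D \<restriction> T) (Inr -` B')" and un: "unentered (D \<restriction> T) (Inr -` B') = Inl -` B'"
      using that arb_iff by auto
    then have "finite (Inl -` B')" using fin_un by metis
    from sum_w_T[OF this fin_br(1)[OF br]] show ?thesis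
      by (simp only: un Inl_Un_Inr_vimage)
  qed
  have arbB: "arborescence (D_T D T) None B"
    and unB: "unentered (D \<restriction> T) (Inr -` B \<inter> arcs (D \<restriction> T)) = suppp T \<zeta>"
    using B by (simp_all add: is_arg_min_def)
  show ?th1 using arbB arb_iff by blast
  then show th2: ?th2 using unB fin_br by simp
  obtain C0 where C0: "branching (D \<restriction> T) C0" "unentered (D \<restriction> T) C0 = suppp T \<zeta>"
    and gT: "g_T D T w \<zeta> = ereal (of_int (sum w C0))"
    using g_T_attained[OF D(1) fin] .
  \<comment> \<open>A branching attaining \<open>g_T\<close> at \<zeta>, joined to the root. It has
    the same root arcs as \<open>B\<close>, so these cancel when the weights are compared.\<close>
  define B0 where "B0 = (Inl ` suppp T \<zeta> \<union> Inr ` C0 :: ('a + 'b) set)"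
  have vimB0: "Inl -` B0 = suppp T \<zeta>" "Inr -` B0 = C0" by (auto simp: B0_def)
  have arb0: "arborescence (D_T D T) None B0" using C0 by (simp add: arb_iff vimB0)
  then have "(\<Sum>a\<in>B. w_T w q a) \<le> (\<Sum>a\<in>B0. w_T w q a)"
    using B C0 fin_br[OF C0(1)] unfolding is_arg_min_def by (metis linorder_not_less vimB0(2))
  then have B_le: "sum w (Inr -` B) \<le> sum w C0"
    by (simp add: weight arbB arb0 vimB0 C0 th2)
  obtain B1 \<rho>1 where B1: "arborescence (D_T D T) None B1"
    and \<rho>1: "dual_T_feasible D T w q \<rho>1" "of_int (\<Sum>a\<in>B1. w_T w q a) \<le> rooted_dual_obj T \<rho>1"
    using arborescence_duality[OF D T] .
  define P where "P = unentered (D \<restriction> T) (Inr -` B1)"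
  \<comment> \<open>The 0/1 vector of the roots of \<open>B1\<close> turns the root-arc weight of
    \<open>B1\<close> into the linear term of the shifted function.\<close>
  define \<eta> :: "'a \<Rightarrow> int" where "\<eta> v = (if v \<in> P then 1 else 0)" for v
  have PT: "P \<subseteq> T" by (auto simp: P_def unentered_def)
  then have supp: "suppp T \<eta> = P" "nonneg_on T \<eta>" by (auto simp: suppp_def nonneg_on_def \<eta>_def)
  have sum\<eta>: "(\<Sum>v\<in>T. q v * \<eta> v) = sum q P"
  proof -
    have "(\<Sum>v\<in>T. q v * \<eta> v) = (\<Sum>v\<in>T. if v \<in> P then q v else 0)"
      by (intro sum.cong) (auto simp: \<eta>_def)
    also have "\<dots> = sum q P" using T PT by (simp add: sum.inter_restrict[symmetric] Int_absorb1)
    finally show ?thesis .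
  qed
  have "g_T D T w \<eta> \<le> ereal (of_int (sum w (Inr -` B1)))"
    using B1 supp by (intro g_T_le D) (auto simp: arb_iff P_def)
  then have "g_T_shift D T w q \<eta> \<le> ereal (of_int (sum w (Inr -` B1))) + ereal (of_int (sum q P))"
    unfolding g_T_shift_def sum\<eta> by (rule add_right_mono)
  moreover have "g_T_shift D T w q \<zeta> \<le> g_T_shift D T w q \<eta>"
    using opt supp(2) by (auto simp: is_arg_min_def not_less)
  ultimately have "g_T_shift D T w q \<zeta> \<le> ereal (of_int (sum w (Inr -` B1))) + ereal (of_int (sum q P))"
    by (rule order_trans[rotated])
  then have "sum w C0 + (\<Sum>v\<in>T. q v * \<zeta> v) \<le> sum w (Inr -` B1) + sum q P"
    by (simp only: g_T_shift_def gT plus_ereal.simps ereal_less_eq of_int_add[symmetric] of_int_le_iff)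
  also have "\<dots> = (\<Sum>a\<in>B1. w_T w q a)" using weight[OF B1] by (simp add: P_def)
  finally have le: "sum w C0 + (\<Sum>v\<in>T. q v * \<zeta> v) \<le> (\<Sum>a\<in>B1. w_T w q a)" .
  have "(\<Sum>v\<in>T. q v * \<zeta> v) + sum w (Inr -` B) \<le> (\<Sum>a\<in>B1. w_T w q a)"
    using le B_le by linarith
  then have "of_int ((\<Sum>v\<in>T. q v * \<zeta> v) + sum w (Inr -` B)) \<le> real_of_int (\<Sum>a\<in>B1. w_T w q a)"
    by (simp only: of_int_le_iff)
  also have "\<dots> \<le> rooted_dual_obj T \<rho>1" by (rule \<rho>1(2))
  also have "\<dots> \<le> rooted_dual_obj T \<rho>"
    using \<rho> \<rho>1(1) by (auto simp: is_arg_max_def not_less)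
  finally show ?th3 .
qed

subsection \<open>Reversal and weak duality\<close>

lemma rev_digraph_simps [simp]:
  "verts (rev_digraph G) = verts G" "arcs (rev_digraph G) = arcs G"
  "tail (rev_digraph G) = head G" "head (rev_digraph G) = tail G"
  by (simp_all add: rev_digraph_def)

lemma rev_induce_subgraph: "rev_digraph (D \<restriction> S) = rev_digraph D \<restriction> S"
  by (auto simp: rev_digraph_def induce_subgraph_def)

lemma rev_D_S: "rev_digraph (D_S D S) = D_T (rev_digraph D) S"
  by (auto simp: rev_digraph_def D_S_def D_T_def induce_subgraph_def)

lemma arcs_rev_induce: "arcs (rev_digraph D \<restriction> S) = arcs (D \<restriction> S)"
  by auto

lemma w_S_eq: "w_S w p = w_T w (\<lambda>u. - p u)"
  by (simp add: w_S_def w_T_def)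

lemma unleft_eq: "unleft G B = unentered (rev_digraph G) B"
  by (simp add: unleft_def unentered_def in_arcs_def out_arcs_def)

lemma cut_out_eq: "cut_out G X = cut_in (rev_digraph G) X"
  by (auto simp: cut_out_def cut_in_def)

lemma g_S_eq: "g_S D S w \<eta> = g_T (rev_digraph D) S w \<eta>"
  by (simp add: g_S_def g_T_def cobranching_def unleft_eq rev_induce_subgraph)

lemma g_S_shift_eq: "g_S_shift D S w p = g_T_shift (rev_digraph D) S w (\<lambda>u. - p u)"
  by (rule ext) (simp add: g_S_shift_def g_T_shift_def g_S_eq minus_ereal_def sum_negf)

lemma dual_S_feasible_eq:
  "dual_S_feasible D S w p = dual_T_feasible (rev_digraph D) S w (\<lambda>u. - p u)"
  by (rule ext)
    (simp add: dual_S_feasible_def dual_T_feasible_def w_S_eq cut_out_eq flip: rev_D_S)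

lemma fin_digraph_rev:
  assumes "fin_digraph D"
  shows "fin_digraph (rev_digraph D)"
proof -
  interpret fin_digraph D by fact
  show ?thesis by unfold_locales simp_all
qed

lemma loopfree_digraph_rev:
  assumes "loopfree_digraph D"
  shows "loopfree_digraph (rev_digraph D)"
proof -
  interpret loopfree_digraph D by fact
  show ?thesis by unfold_locales (auto dest: no_loops)
qed

lemma arborescence_le_rooted_dual_S:
  fixes D :: "('a, 'b) pre_digraph"
  assumes D: "fin_digraph D" "loopfree_digraph D" and S: "finite S"
    and opt: "is_arg_min (g_S_shift D S w p) (nonneg_on S) \<eta>" and fin: "g_S D S w \<eta> < \<infinity>"
    and B: "is_arg_min (\<lambda>B. \<Sum>a\<in>B. w_S w p a)
        (\<lambda>B. arborescence (rev_digraph (D_S D S)) None B \<and>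
             unleft (D \<restriction> S) (Inr -` B \<inter> arcs (D \<restriction> S)) = suppp S \<eta>) B"
    and \<pi>: "is_arg_max (rooted_dual_obj S) (dual_S_feasible D S w p) \<pi>"
  shows "branching (rev_digraph D \<restriction> S) (Inr -` B)"
    and "unentered (rev_digraph D \<restriction> S) (Inr -` B) = suppp S \<eta>"
    and "of_int ((\<Sum>u\<in>S. - p u * \<eta> u) + sum w (Inr -` B)) \<le> rooted_dual_obj S \<pi>"
  using arborescence_le_rooted_dual[OF fin_digraph_rev[OF D(1)] loopfree_digraph_rev[OF D(2)] S,
      of w "\<lambda>u. - p u" \<eta> B \<pi>] assms
  unfolding g_S_shift_eq g_S_eq w_S_eq rev_D_S unleft_eq rev_induce_subgraph arcs_rev_induce
    dual_S_feasible_eq by blast+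

text \<open>Contracting everything outside \<open>T\<close> to the root sends an arc from outside to
  the root arc of its head, which enters the same subsets of \<open>T\<close>.\<close>

lemma dual_T_feasible_cut_le:
  assumes D: "loopfree_digraph D" and T: "finite T" and \<rho>: "dual_T_feasible D T w q \<rho>"
    and a: "a \<in> arcs D" "head D a \<in> T"
  shows "(\<Sum>T' | T' \<in> nonempty_subsets T \<and> a \<in> cut_in D T'. \<rho> T')
    \<le> of_int (if tail D a \<in> T then w a else q (head D a))"
proof -
  define b where "b = (if tail D a \<in> T then Inr a else Inl (head D a))"
  have b: "b \<in> arcs (D_T D T)" using a by (simp add: b_def D_T_def)
  have "(\<Sum>T' | T' \<in> nonempty_subsets T \<and> a \<in> cut_in D T'. \<rho> T') =
      (\<Sum>T' | T' \<in> nonempty_subsets T \<and> b \<in> cut_in (D_T D T) (Some ` T'). \<rho> T')"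
    using a by (intro sum.cong) (auto simp: b_def cut_in_iff D_T_def nonempty_subsets_def)
  also have "\<dots> \<le> of_int (w_T w q b)"
    using \<rho> b unfolding dual_T_feasible_iff[OF D T] by blast
  finally show ?thesis by (simp add: b_def w_T_def split: if_splits)
qed

lemma dual_S_feasible_cut_le:
  assumes "loopfree_digraph D" "finite S" "dual_S_feasible D S w p \<pi>" "a \<in> arcs D" "tail D a \<in> S"
  shows "(\<Sum>S' | S' \<in> nonempty_subsets S \<and> a \<in> cut_out D S'. \<pi> S')
    \<le> of_int (if head D a \<in> S then w a else - p (tail D a))"
  using dual_T_feasible_cut_le[OF loopfree_digraph_rev[OF assms(1)] assms(2), of w "\<lambda>u. - p u" \<pi> a]
    assms(3-) by (simp add: dual_S_feasible_eq cut_out_eq cong: if_cong)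

text \<open>By well-foundedness some vertex of \<open>X\<close> has no predecessor in
  \<open>X\<close> along \<open>C\<close>: it is either unentered or entered from outside
  \<open>X\<close>.\<close>

lemma branching_enters:
  assumes D: "fin_digraph D" and C: "branching (D \<restriction> T) C" and X: "X \<in> nonempty_subsets T"
  shows "C \<inter> cut_in D X \<noteq> {} \<or> X \<inter> unentered (D \<restriction> T) C \<noteq> {}"
proof -
  interpret fin_digraph D by fact
  have "wf_digraph (D \<restriction> T)" by (rule wellformed_induce_subgraph)
  then have "wf (ends (D \<restriction> T) C)" "C \<subseteq> arcs (D \<restriction> T)"
    using C by (simp_all add: branching_iff_wf)
  moreover obtain x where "x \<in> X" using X by (auto simp: nonempty_subsets_def)
  ultimately obtain v where v: "v \<in> X" "\<And>u. (u, v) \<in> ends (D \<restriction> T) C \<Longrightarrow> u \<notin> X"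
    by (metis wfE_min)
  show ?thesis
  proof (cases "v \<in> unentered (D \<restriction> T) C")
    case False
    then obtain a where a: "a \<in> C" "a \<in> arcs D" "head D a = v"
      using v(1) X by (auto simp: unentered_def nonempty_subsets_def in_arcs_def)
    then have "(tail D a, v) \<in> ends (D \<restriction> T) C" by (force simp: ends_def)
    then show ?thesis using a v by (auto simp: cut_in_iff)
  qed (use v in blast)
qed

lemma weak_duality:
  assumes D: "fin_digraph D" and fin: "finite S" "finite T"
    and x: "primal_feasible D S T x" and yz: "dual_feasible D S T w (y, z)"
  shows "dual_obj S T (y, z) \<le> primal_obj D w x"
proof -
  interpret fin_digraph D by fact
  \<comment> \<open>Exchanging the order of summation, stated for a generic \<open>cut\<close> so
    that it serves both families of sets.\<close>
  have swap: "sum y (nonempty_subsets X) \<le>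
      (\<Sum>a\<in>arcs D. (\<Sum>X' | X' \<in> nonempty_subsets X \<and> a \<in> cut X'. y X') * x a)"
    if X: "finite X" and cut: "\<And>X'. cut X' \<subseteq> arcs D"
      and x: "\<And>X'. X' \<in> nonempty_subsets X \<Longrightarrow> sum x (cut X') \<ge> 1"
      and y: "\<And>X'. X' \<in> nonempty_subsets X \<Longrightarrow> y X' \<ge> 0"
    for X y and cut :: "'a set \<Rightarrow> 'b set"
  proof -
    have "sum y (nonempty_subsets X) \<le> (\<Sum>X'\<in>nonempty_subsets X. y X' * sum x (cut X'))"
    proof (rule sum_mono)
      fix X' assume "X' \<in> nonempty_subsets X"
      from mult_left_mono[OF x[OF this] y[OF this]]
      show "y X' \<le> y X' * sum x (cut X')" by simp
    qed
    also have "\<dots> = (\<Sum>X'\<in>nonempty_subsets X. \<Sum>a\<in>{a \<in> arcs D. a \<in> cut X'}. y X' * x a)"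
      using cut by (intro sum.cong) (auto simp: sum_distrib_left intro!: sum.cong)
    also have "\<dots> = (\<Sum>a\<in>arcs D. \<Sum>X'\<in>{X' \<in> nonempty_subsets X. a \<in> cut X'}. y X' * x a)"
      using X by (intro sum.swap_restrict) simp_all
    finally show ?thesis by (simp add: sum_distrib_right)
  qed
  have "dual_obj S T (y, z) \<le>
      (\<Sum>a\<in>arcs D. (\<Sum>S' | S' \<in> nonempty_subsets S \<and> a \<in> cut_out D S'. y S') * x a) +
      (\<Sum>a\<in>arcs D. (\<Sum>T' | T' \<in> nonempty_subsets T \<and> a \<in> cut_in D T'. z T') * x a)"
    unfolding dual_obj_def prod.case
    using x yz fin by (intro add_mono swap)
      (auto simp: primal_feasible_def dual_feasible_def cut_in_def cut_out_def)
  also have "\<dots> = (\<Sum>a\<in>arcs D. ((\<Sum>S' | S' \<in> nonempty_subsets S \<and> a \<in> cut_out D S'. y S') +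
      (\<Sum>T' | T' \<in> nonempty_subsets T \<and> a \<in> cut_in D T'. z T')) * x a)"
    by (simp add: sum.distrib distrib_right)
  also have "\<dots> \<le> primal_obj D w x"
    unfolding primal_obj_def using x yz
    by (intro sum_mono mult_right_mono) (auto simp: primal_feasible_def dual_feasible_def)
  finally show ?thesis .
qed

section \<open>Optimality of the assembled primal and dual solutions\<close>

theorem theorem5:
  fixes D :: "('a, 'b) pre_digraph" and S T :: "'a set" and w :: "'b \<Rightarrow> int"
    and \<xi> :: "'b \<Rightarrow> int" and p q :: "'a \<Rightarrow> int"
    and B\<^sub>T B\<^sub>S :: "('a + 'b) set" and \<rho> \<pi> :: "'a set \<Rightarrow> real"
    and F :: "'b set" and x :: "'b \<Rightarrow> real" and y z :: "'a set \<Rightarrow> real"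
  assumes D: "fin_digraph D" "loopfree_digraph D"
    and partition: "S \<union> T = verts D" "S \<inter> T = {}" "S \<noteq> {}" "T \<noteq> {}"
    and no_TS: "arcs_between D T S = {}"
    and w: "\<forall>a \<in> arcs D. w a \<ge> 0"
    and \<xi>: "optimal_flow D S T w \<xi>"
    and pq: "potential_conditions D S T w \<xi> p q"
    and tight: "\<forall>a \<in> arcs_between D S T. \<xi> a = 1 \<longrightarrow> w a + p (tail D a) - q (head D a) = 0"
    and B\<^sub>T: "is_arg_min (\<lambda>B. \<Sum>a\<in>B. w_T w q a)
        (\<lambda>B. arborescence (D_T D T) None B \<and>
             unentered (D \<restriction> T) (Inr -` B \<inter> arcs (D \<restriction> T)) = suppp T (\<lambda>v. - boundary D S T \<xi> v))
        B\<^sub>T"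
    and \<rho>: "is_arg_max (rooted_dual_obj T) (dual_T_feasible D T w q) \<rho>"
    and \<rho>_int: "\<forall>T' \<in> nonempty_subsets T. \<rho> T' \<in> \<int>"
    and \<rho>_nonneg: "\<forall>v \<in> T. \<rho> {v} \<ge> 0"
    and B\<^sub>S: "is_arg_min (\<lambda>B. \<Sum>a\<in>B. w_S w p a)
        (\<lambda>B. arborescence (rev_digraph (D_S D S)) None B \<and>
             unleft (D \<restriction> S) (Inr -` B \<inter> arcs (D \<restriction> S)) = suppp S (boundary D S T \<xi>))
        B\<^sub>S"
    and \<pi>: "is_arg_max (rooted_dual_obj S) (dual_S_feasible D S w p) \<pi>"
    and \<pi>_int: "\<forall>S' \<in> nonempty_subsets S. \<pi> S' \<in> \<int>"
    and \<pi>_nonneg: "\<forall>u \<in> S. \<pi> {u} \<ge> 0"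
    and F: "F = {a \<in> arcs_between D S T. \<xi> a = 1}"
    and x: "\<forall>a \<in> arcs D. x a =
        indicator (F \<union> (Inr -` B\<^sub>S \<inter> arcs (D \<restriction> S)) \<union> (Inr -` B\<^sub>T \<inter> arcs (D \<restriction> T))) a"
    and y: "\<forall>S' \<in> nonempty_subsets S. y S' = \<pi> S'"
    and z: "\<forall>T' \<in> nonempty_subsets T. z T' = \<rho> T'"
  shows "is_arg_min (primal_obj D w) (primal_feasible D S T) x \<and>
         is_arg_max (dual_obj S T) (dual_feasible D S T w) (y, z)"
proof -
  interpret D: fin_digraph D by fact
  have fin: "finite S" "finite T" using partition(1) D.finite_verts by (metis finite_Un)+
  let ?\<eta> = "boundary D S T \<xi>" and ?\<zeta> = "\<lambda>v. - boundary D S T \<xi> v"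
  define C\<^sub>S C\<^sub>T where "C\<^sub>S = Inr -` B\<^sub>S" and "C\<^sub>T = Inr -` B\<^sub>T"
  have flow: "\<forall>a\<in>arcs_between D S T. \<xi> a \<in> {0, 1}" "g_S D S w ?\<eta> < \<infinity>" "g_T D T w ?\<zeta> < \<infinity>"
    using \<xi> by (simp_all add: optimal_flow_def is_arg_min_def msf_feasible_def)
  have pot: "\<forall>a\<in>arcs_between D S T. \<xi> a = 0 \<longrightarrow> w a + p (tail D a) - q (head D a) \<ge> 0"
    "is_arg_min (g_S_shift D S w p) (nonneg_on S) ?\<eta>"
    "is_arg_min (g_T_shift D T w q) (nonneg_on T) ?\<zeta>"
    using pq by (auto simp: potential_conditions_def)
  note side_T = arborescence_le_rooted_dual[OF D fin(2) pot(3) flow(3) B\<^sub>T \<rho>, folded C\<^sub>T_def]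
  note side_S = arborescence_le_rooted_dual_S[OF D fin(1) pot(2) flow(2) B\<^sub>S \<pi>, folded C\<^sub>S_def]
  have C_sub: "C\<^sub>S \<subseteq> arcs (D \<restriction> S)" "C\<^sub>T \<subseteq> arcs (D \<restriction> T)"
    using side_S(1) side_T(1) by (auto simp: branching_def)
  have F_sub: "F \<subseteq> arcs D" "tail D ` F \<subseteq> S" "head D ` F \<subseteq> T"
    by (auto simp: F arcs_between_def)
  have finF: "finite F" "finite C\<^sub>S" "finite C\<^sub>T"
    using F_sub(1) C_sub by (auto intro!: finite_subset[OF _ D.finite_arcs])
  have bd_S: "?\<eta> u = int (card {a \<in> F. tail D a = u})" if "u \<in> S" for u
  proof -
    have "{a \<in> arcs_between D S T. head D a = u \<and> \<xi> a = 1} = {}"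
      using that partition(2) by (auto simp: arcs_between_def)
    moreover have "{a \<in> arcs_between D S T. tail D a = u \<and> \<xi> a = 1} = {a \<in> F. tail D a = u}"
      by (auto simp: F)
    ultimately show ?thesis unfolding boundary_def by (simp only: card.empty of_nat_0 diff_0 diff_0_right minus_minus)
  qed
  have bd_T: "?\<zeta> v = int (card {a \<in> F. head D a = v})" if "v \<in> T" for v
  proof -
    have "{a \<in> arcs_between D S T. tail D a = v \<and> \<xi> a = 1} = {}"
      using that partition(2) by (auto simp: arcs_between_def)
    moreover have "{a \<in> arcs_between D S T. head D a = v \<and> \<xi> a = 1} = {a \<in> F. head D a = v}"
      by (auto simp: F)
    ultimately show ?thesis unfolding boundary_def by (simp only: card.empty of_nat_0 diff_0 diff_0_right minus_minus)
  qed
  \<comment> \<open>The boundary counts arcs of \<open>F\<close> at each vertex, so the linear terms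
    in \<open>p\<close> and \<open>q\<close> become sums over the arcs of \<open>F\<close>.\<close>
  have "(\<Sum>u\<in>S. - p u * ?\<eta> u) = (\<Sum>u\<in>S. \<Sum>a\<in>{a \<in> F. tail D a = u}. - p (tail D a))"
    by (intro sum.cong) (simp_all add: bd_S)
  also have "\<dots> = (\<Sum>a\<in>F. - p (tail D a))"
    using finF fin F_sub by (intro sum.group) auto
  finally have p_sum: "(\<Sum>u\<in>S. - p u * ?\<eta> u) = (\<Sum>a\<in>F. - p (tail D a))" .
  have "(\<Sum>v\<in>T. q v * ?\<zeta> v) = (\<Sum>v\<in>T. \<Sum>a\<in>{a \<in> F. head D a = v}. q (head D a))"
    by (intro sum.cong) (simp_all only: bd_T, simp_all)
  also have "\<dots> = (\<Sum>a\<in>F. q (head D a))"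
    using finF fin F_sub by (intro sum.group) auto
  finally have q_sum: "(\<Sum>v\<in>T. q v * ?\<zeta> v) = (\<Sum>a\<in>F. q (head D a))" .
  have "sum w F = (\<Sum>a\<in>F. - p (tail D a) + q (head D a))"
    using tight by (intro sum.cong) (auto simp: F)
  then have w_F: "sum w F = (\<Sum>u\<in>S. - p u * ?\<eta> u) + (\<Sum>v\<in>T. q v * ?\<zeta> v)"
    by (simp only: p_sum q_sum sum.distrib)

  \<comment> \<open>Comparison of the two objective values\<close>
  define X where "X = F \<union> C\<^sub>S \<union> C\<^sub>T"
  have X_sub: "X \<subseteq> arcs D" using F_sub C_sub by (auto simp: X_def)
  have x_eq: "x a = indicator X a" if "a \<in> arcs D" for a
    using x that C_sub by (simp add: X_def C\<^sub>S_def C\<^sub>T_def Int_absorb2)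
  have "primal_obj D w x = (\<Sum>a\<in>arcs D. of_int (w a) * indicator X a)"
    unfolding primal_obj_def by (intro sum.cong) (simp_all add: x_eq)
  also have "\<dots> = of_int (sum w X)"
    using X_sub D.finite_arcs by (simp add: sum_mult_indicator Int_absorb1)
  also have "sum w X = sum w F + sum w C\<^sub>S + sum w C\<^sub>T"
  proof -
    \<comment> \<open>The three parts are disjoint because their arcs run from \<open>S\<close> to
      \<open>T\<close>, inside \<open>S\<close> and inside \<open>T\<close>, respectively.\<close>
    have "head D ` F \<subseteq> T" "head D ` C\<^sub>S \<subseteq> S" "tail D ` (F \<union> C\<^sub>S) \<subseteq> S" "tail D ` C\<^sub>T \<subseteq> T"
      using C_sub F_sub by auto
    then have "F \<inter> C\<^sub>S = {}" "(F \<union> C\<^sub>S) \<inter> C\<^sub>T = {}"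
      using partition(2) by blast+
    then show ?thesis using finF by (simp add: X_def sum.union_disjoint)
  qed
  also have "real_of_int \<dots> \<le> rooted_dual_obj S \<pi> + rooted_dual_obj T \<rho>"
    using side_S(3) side_T(3) unfolding w_F by linarith
  also have "\<dots> = dual_obj S T (y, z)"
    using y z by (simp add: rooted_dual_obj_eq fin dual_obj_def)
  finally have obj: "primal_obj D w x \<le> dual_obj S T (y, z)" .

  \<comment> \<open>Primal feasibility\<close>
  have enough: "1 \<le> sum x Y" if Y: "Y \<subseteq> arcs D" and ne: "X \<inter> Y \<noteq> {}" for Y
  proof -
    have finY: "finite Y" using Y D.finite_arcs finite_subset by blast
    obtain a where a: "a \<in> X" "a \<in> Y" using ne by blast
    have "x a \<le> sum x Y"
      using finY Y a x_eq by (intro member_le_sum) auto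
    then show ?thesis using a Y x_eq[of a] by auto
  qed
  have primal: "primal_feasible D S T x"
    unfolding primal_feasible_def
  proof (intro conjI ballI)
    fix S' assume S': "S' \<in> nonempty_subsets S"
    show "1 \<le> sum x (cut_out D S')"
    proof (rule enough)
      \<comment> \<open>Either the cobranching leaves \<open>S'\<close>, or \<open>S'\<close>
        contains one of its roots. At such a root the boundary is positive, so an arc of
        \<open>F\<close> goes from there to \<open>T\<close> and thereby leaves
        \<open>S'\<close>.\<close>
      consider a where "a \<in> C\<^sub>S" "a \<in> cut_out D S'" | u where "u \<in> S'" "u \<in> suppp S ?\<eta>"
        using branching_enters[OF fin_digraph_rev[OF D(1)] side_S(1) S'] side_S(2)
        by (auto simp: cut_out_eq)
      then show "X \<inter> cut_out D S' \<noteq> {}"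
      proof cases
        case 2
        then have "?\<eta> u > 0" "u \<in> S" by (simp_all only: suppp_def mem_Collect_eq)
        then have "card {a \<in> F. tail D a = u} \<noteq> 0" using bd_S[of u] by linarith
        then have "{a \<in> F. tail D a = u} \<noteq> {}" by (metis card.empty)
        then obtain a where a: "a \<in> F" "tail D a = u" by blast
        moreover have "head D a \<notin> S'"
          using a(1) F_sub(3) partition(2) S' by (auto simp: nonempty_subsets_def)
        ultimately have "a \<in> X \<inter> cut_out D S'"
          using 2 F_sub(1) by (auto simp: X_def cut_out_def)
        then show ?thesis by blast
      qed (auto simp: X_def)
    qed (auto simp: cut_out_def)
  next
    fix T' assume T': "T' \<in> nonempty_subsets T"
    show "1 \<le> sum x (cut_in D T')"
    proof (rule enough)
      consider a where "a \<in> C\<^sub>T" "a \<in> cut_in D T'" | v where "v \<in> T'" "v \<in> suppp T ?\<zeta>"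
        using branching_enters[OF D(1) side_T(1) T'] side_T(2) by auto
      then show "X \<inter> cut_in D T' \<noteq> {}"
      proof cases
        case 2
        then have "?\<zeta> v > 0" "v \<in> T" by (simp_all only: suppp_def mem_Collect_eq)
        then have "card {a \<in> F. head D a = v} \<noteq> 0" using bd_T[of v] by linarith
        then have "{a \<in> F. head D a = v} \<noteq> {}" by (metis card.empty)
        then obtain a where a: "a \<in> F" "head D a = v" by blast
        moreover have "tail D a \<notin> T'"
          using a(1) F_sub(2) partition(2) T' by (auto simp: nonempty_subsets_def)
        ultimately have "a \<in> X \<inter> cut_in D T'"
          using 2 F_sub(1) by (auto simp: X_def cut_in_iff)
        then show ?thesis by blast
      qed (auto simp: X_def)
    qed (auto simp: cut_in_iff)
  qed (simp add: x_eq)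

  \<comment> \<open>Dual feasibility\<close>
  have \<rho>_feas: "dual_T_feasible D T w q \<rho>" and \<pi>_feas: "dual_S_feasible D S w p \<pi>"
    using \<rho> \<pi> by (simp_all add: is_arg_max_def)
  have dual: "dual_feasible D S T w (y, z)"
    unfolding dual_feasible_def prod.case
  proof (intro conjI ballI)
    fix a assume a: "a \<in> arcs D"
    have y_sum: "(\<Sum>S' | S' \<in> nonempty_subsets S \<and> a \<in> cut_out D S'. y S') =
        (\<Sum>S' | S' \<in> nonempty_subsets S \<and> a \<in> cut_out D S'. \<pi> S')"
      using y by (intro sum.cong) auto
    have z_sum: "(\<Sum>T' | T' \<in> nonempty_subsets T \<and> a \<in> cut_in D T'. z T') =
        (\<Sum>T' | T' \<in> nonempty_subsets T \<and> a \<in> cut_in D T'. \<rho> T')"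
      using z by (intro sum.cong) auto
    have no_y: "sum \<pi> {S'. S' \<in> nonempty_subsets S \<and> a \<in> cut_out D S'} = 0" if "tail D a \<in> T"
      using that partition(2) by (intro sum.neutral) (auto simp: nonempty_subsets_def cut_out_def)
    have no_z: "sum \<rho> {T'. T' \<in> nonempty_subsets T \<and> a \<in> cut_in D T'} = 0" if "head D a \<in> S"
      using that partition(2) by (intro sum.neutral) (auto simp: nonempty_subsets_def cut_in_def)
    note le_S = dual_S_feasible_cut_le[OF D(2) fin(1) \<pi>_feas a]
    note le_T = dual_T_feasible_cut_le[OF D(2) fin(2) \<rho>_feas a]
    have "tail D a \<in> S \<union> T" "head D a \<in> S \<union> T"
      using a partition(1) by simp_all
    moreover have "\<not> (tail D a \<in> T \<and> head D a \<in> S)"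
      using no_TS a by (auto simp: arcs_between_def)
    ultimately consider "tail D a \<in> S" "head D a \<in> S" | "tail D a \<in> T" "head D a \<in> T" |
      "tail D a \<in> S" "head D a \<in> T" by blast
    then have "sum \<pi> {S'. S' \<in> nonempty_subsets S \<and> a \<in> cut_out D S'}
        + sum \<rho> {T'. T' \<in> nonempty_subsets T \<and> a \<in> cut_in D T'} \<le> of_int (w a)"
    proof cases
      case 1
      then show ?thesis
        using le_S no_z by simp
    next
      case 2
      then show ?thesis
        using le_T no_y by simp
    next
      case 3
      then have "a \<in> arcs_between D S T" "head D a \<notin> S" "tail D a \<notin> T"
        using a partition(2) by (auto simp: arcs_between_def)
      \<comment> \<open>An arc from \<open>S\<close> to \<open>T\<close> meets both families of
        cuts, with bounds \<open>- p (tail D a)\<close> and \<open>q (head D a)\<close>. Condition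
        (i) for \<xi> zero, or tightness for \<xi> one, bounds their sum by
        \<open>w a\<close>.\<close>
      then have "q (head D a) - p (tail D a) \<le> w a"
        using flow(1) pot(1) tight by force
      then have "real_of_int (q (head D a)) - real_of_int (p (tail D a)) \<le> real_of_int (w a)"
        by linarith
      then show ?thesis
        using le_S le_T 3 \<open>head D a \<notin> S\<close> \<open>tail D a \<notin> T\<close> by simp
    qed
    then show "(\<Sum>S' | S' \<in> nonempty_subsets S \<and> a \<in> cut_out D S'. y S')
        + (\<Sum>T' | T' \<in> nonempty_subsets T \<and> a \<in> cut_in D T'. z T') \<le> of_int (w a)"
      by (simp only: y_sum z_sum)
  next
    \<comment> \<open>Singletons are nonnegative by assumption, larger sets by feasibility in the
      rooted dual; the same holds for \<open>T'\<close>.\<close>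
    fix S' assume S': "S' \<in> nonempty_subsets S"
    then show "0 \<le> y S'"
      using y \<pi>_nonneg \<pi>_feas unfolding nonempty_subsets_eq[OF fin(1)]
      by (auto simp: dual_S_feasible_def)
  next
    fix T' assume T': "T' \<in> nonempty_subsets T"
    then show "0 \<le> z T'"
      using z \<rho>_nonneg \<rho>_feas unfolding nonempty_subsets_eq[OF fin(2)]
      by (auto simp: dual_T_feasible_def)
  qed

  show ?thesis
    unfolding is_arg_min_def is_arg_max_def
  proof (intro conjI primal dual notI; elim exE conjE)
    fix x' assume "primal_feasible D S T x'" "primal_obj D w x' < primal_obj D w x"
    then show False using weak_duality[OF D(1) fin _ dual] obj by fastforce
  next
    fix yz' assume "dual_feasible D S T w yz'" "dual_obj S T (y, z) < dual_obj S T yz'"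
    then show False using weak_duality[OF D(1) fin primal, of w "fst yz'" "snd yz'"] obj by simp
  qed
qed

end
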